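(* Let $a,b,c,p,q,r\in\mathbb{R}$, let $Q(x,y,z):=ax^2+2bxy+2pxz+cy^2+2qyz+rz^2$, and let $$\Delta:=\det\begin{pmatrix} a & b & p\\ b & c & q\\ p & q & r\end{pmatrix}.$$ Then, identically in $x,y,z$, $$a(ac-b^2)\,Q(x,y,z)=(ac-b^2)(ax+by+pz)^2+\left[(ac-b^2)y+(aq-bp)z\right]^2+a\Delta z^2.$$ In particular, when $a\neq 0$ and $ac-b^2\neq 0$, $$Q(x,y,z)=\frac{a}{1}\left(x+\frac{b}{a}y+\frac{p}{a}z\right)^2+\frac{ac-b^2}{a}\left(y+\frac{aq-bp}{ac-b^2}z\right)^2+\frac{\Delta}{ac-b^2}z^2.$$ *)

theory Defs
  imports "HOL-Analysis.Analysis"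
begin

definition ternary_form ::
  "real \<Rightarrow> real \<Rightarrow> real \<Rightarrow> real \<Rightarrow> real \<Rightarrow> real \<Rightarrow> real \<Rightarrow> real \<Rightarrow> real \<Rightarrow> real" where
  "ternary_form a b c p q r x y z =
     a * x\<^sup>2 + 2 * b * x * y + 2 * p * x * z + c * y\<^sup>2 + 2 * q * y * z + r * z\<^sup>2"

definition ternary_det ::
  "real \<Rightarrow> real \<Rightarrow> real \<Rightarrow> real \<Rightarrow> real \<Rightarrow> real \<Rightarrow> real" where
  "ternary_det a b c p q r =
     det (vector [vector [a, b, p],
                  vector [b, c, q],
                  vector [p, q, r]] :: real^3^3)"

end

theory Submission
  imports Defs
begin

text \<open>Complete squares twice. With D = a*c - b^2, e = a*q - b*p and f = a*r - p^2, the first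
  completion gives a*Q = (a*x + b*y + p*z)^2 + (D*y^2 + 2*e*y*z + f*z^2). Multiplying the binary
  form by D and completing again leaves (D*f - e^2)*z^2, and D*f - e^2 = a*\<Delta> (Sylvester's
  determinant identity). \<open>ternary_form_Jacobi\<close> checks the combined identity as one of
  polynomials; \<open>ternary_form_Jacobi_divided\<close> divides it by a*D.\<close>

lemma ternary_det_expand:
  "ternary_det a b c p q r = a * c * r + 2 * b * p * q - a * q\<^sup>2 - c * p\<^sup>2 - r * b\<^sup>2"
  by (simp add: ternary_det_def det_3 power2_eq_square algebra_simps)

lemma ternary_form_Jacobi:
  "a * (a * c - b\<^sup>2) * ternary_form a b c p q r x y z =
     (a * c - b\<^sup>2) * (a * x + b * y + p * z)\<^sup>2
     + ((a * c - b\<^sup>2) * y + (a * q - b * p) * z)\<^sup>2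
     + a * ternary_det a b c p q r * z\<^sup>2"
  unfolding ternary_form_def ternary_det_expand by algebra

text \<open>As a*D is nonzero, it suffices to compare both sides after multiplication by a*D, where
  the division-free identity applies.\<close>

lemma ternary_form_Jacobi_divided:
  assumes a: "a \<noteq> 0" and minor: "a * c - b\<^sup>2 \<noteq> 0"
  shows "ternary_form a b c p q r x y z =
     a * (x + b / a * y + p / a * z)\<^sup>2
     + (a * c - b\<^sup>2) / a * (y + (a * q - b * p) / (a * c - b\<^sup>2) * z)\<^sup>2
     + ternary_det a b c p q r / (a * c - b\<^sup>2) * z\<^sup>2"
    (is "?Q = ?rhs")
proof -
  define D where "D = a * c - b\<^sup>2"
  define e where "e = a * q - b * p"
  have D: "D \<noteq> 0" using minor by (simp add: D_def)
  have x: "a * (x + b / a * y + p / a * z) = a * x + b * y + p * z"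
    using a by (simp add: field_simps)
  have y: "D * (y + e / D * z) = D * y + e * z"
    using D by (simp add: field_simps)
  \<comment> \<open>Keeping u, v, t, w generic clears the outer denominators without expanding the
    quotients inside the squares: the factor a*D is absorbed as D*a^2, D^2 and a.\<close>
  have scale: "a * D * (a * u\<^sup>2 + D / a * v\<^sup>2 + t / D * w\<^sup>2) =
      D * (a * u)\<^sup>2 + (D * v)\<^sup>2 + a * t * w\<^sup>2" for u v t w :: real
    using a D by (simp add: field_simps power2_eq_square)
  have "a * D * ?rhs = D * (a * (x + b / a * y + p / a * z))\<^sup>2
      + (D * (y + e / D * z))\<^sup>2 + a * ternary_det a b c p q r * z\<^sup>2"
    unfolding D_def[symmetric] e_def[symmetric] by (rule scale)
  \<comment> \<open>The factors a and D now sit inside the squares, where \<open>x\<close> and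
    \<open>y\<close> turn the normalised linear forms into those of
    \<open>ternary_form_Jacobi\<close>.\<close>
  also have "\<dots> = a * D * ?Q"
    unfolding x y by (simp add: ternary_form_Jacobi D_def e_def)
  finally show ?thesis using a D by simp
qed

theorem mainTheorem3:
  fixes a b c p q r :: real
  defines "Q \<equiv> ternary_form a b c p q r"
    and "\<Delta> \<equiv> ternary_det a b c p q r"
  shows "(\<forall>x y z :: real.
            a * (a * c - b\<^sup>2) * Q x y z =
              (a * c - b\<^sup>2) * (a * x + b * y + p * z)\<^sup>2
              + ((a * c - b\<^sup>2) * y + (a * q - b * p) * z)\<^sup>2
              + a * \<Delta> * z\<^sup>2)
       \<and> (a \<noteq> 0 \<and> a * c - b\<^sup>2 \<noteq> 0 \<longrightarrow>
           (\<forall>x y z :: real.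
              Q x y z =
                a / 1 * (x + b / a * y + p / a * z)\<^sup>2
                + (a * c - b\<^sup>2) / a * (y + (a * q - b * p) / (a * c - b\<^sup>2) * z)\<^sup>2
                + \<Delta> / (a * c - b\<^sup>2) * z\<^sup>2))"
  unfolding Q_def \<Delta>_def div_by_1
  using ternary_form_Jacobi ternary_form_Jacobi_divided by blast

end
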